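(* Let $A$ be a densely defined and closable operator on a complex Hilbert space $\mathcal{H}$. Then there is a one-to-one correspondence between all densely defined and closed restrictions of $A^*$ and all subspaces $\mathfrak{M}\subset\mathcal{D}(A^* )$ that are closed with respect to $\|\cdot\|_{\Gamma(A^* )}$ and that satisfy $$\ker (A^* )\cap \overline{\mathfrak{M}}^{\|\cdot\|_{\Gamma(A^* )}}=\{0\}\quad\text{and}\quad\{A^*\phi:\phi\in\overline{\mathfrak{M}}^{\|\cdot\|_{\Gamma(A^* )}}\}\cap\mathcal{D}(A)=\{0\}.$$ These densely defined and closed restrictions are given by the operators $C_\mathfrak{M}$ defined by $$\mathcal{D}(C_\mathfrak{M})=\{f\in\mathcal{D}(A^* ): \langle f,\phi\rangle+\langle A^*f,A^*\phi\rangle=0\ \text{ for all }\ \phi\in\mathfrak{M}\},\qquad C_{\mathfrak{M}}=A^*\upharpoonright_{\mathcal{D}(C_\mathfrak{M})}.$$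
   Context: The scalar product $\langle\cdot,\cdot\rangle$ on $\mathcal{H}$ is antilinear in the first and linear in the second component. $\mathcal{D}(\cdot)$ denotes the domain of an operator and $A^*$ the adjoint of $A$. The graph norm of $A^*$ is given by $\|\phi\|_{\Gamma(A^* )}^2=\|\phi\|^2+\|A^*\phi\|^2$ for $\phi\in\mathcal{D}(A^* )$, and $\overline{\mathfrak{M}}^{\|\cdot\|_{\Gamma(A^* )}}$ denotes the closure of $\mathfrak{M}$ with respect to this norm.
   Formalization: The second condition uses the domain of the closure of A instead of D(A). With D(A) the claim fails for non-closed A: for A the identity on a dense proper subspace and M spanned by a vector outside it, C_M is not densely defined. For closed A the two conditions agree. *)

theory Defs
  imports "HOL-Analysis.Analysis"
begin

section \<open>Complex Hilbert spaces\<close>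

text \<open>The real structure inherited from \<open>real_inner\<close> is the underlying real Hilbert space, so that
  norm and topology are the ones of the library.\<close>

class complex_hilbert_space = real_inner + complete_space +
  fixes scaleC :: "complex \<Rightarrow> 'a \<Rightarrow> 'a" (infixr "*\<^sub>C" 75)
    and cinner :: "'a \<Rightarrow> 'a \<Rightarrow> complex"
  assumes scaleC_add_right: "c *\<^sub>C (x + y) = c *\<^sub>C x + c *\<^sub>C y"
    and scaleC_add_left: "(c + d) *\<^sub>C x = c *\<^sub>C x + d *\<^sub>C x"
    and scaleC_scaleC: "c *\<^sub>C d *\<^sub>C x = (c * d) *\<^sub>C x"
    and scaleR_eq_scaleC: "r *\<^sub>R x = complex_of_real r *\<^sub>C x"
    and cinner_commute: "cinner x y = cnj (cinner y x)"
    and cinner_add_right: "cinner x (y + z) = cinner x y + cinner x z"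
    and cinner_scaleC_right: "cinner x (c *\<^sub>C y) = c * cinner x y"
    and inner_eq_Re_cinner: "inner x y = Re (cinner x y)"

global_interpretation complex_vector:
  vector_space "scaleC :: complex \<Rightarrow> 'a \<Rightarrow> 'a::complex_hilbert_space"
  defines csubspace = complex_vector.subspace
proof
  fix x :: 'a
  show "1 *\<^sub>C x = x"
    using scaleR_eq_scaleC[of 1 x] by simp
qed (simp_all add: scaleC_add_right scaleC_add_left scaleC_scaleC)

lemma cinner_self: "cinner x x = complex_of_real ((norm x)\<^sup>2)"
proof (rule complex_eqI)
  have "Im (cinner x x) = - Im (cinner x x)"
    using arg_cong[OF cinner_commute[of x x], of Im] by simp
  then show "Im (cinner x x) = Im (complex_of_real ((norm x)\<^sup>2))"
    by simp
qed (simp add: inner_eq_Re_cinner[symmetric] power2_norm_eq_inner)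

instantiation complex :: complex_hilbert_space
begin

definition scaleC_complex :: "complex \<Rightarrow> complex \<Rightarrow> complex"
  where "scaleC_complex c x = c * x"

definition cinner_complex :: "complex \<Rightarrow> complex \<Rightarrow> complex"
  where "cinner_complex x y = cnj x * y"

instance
  by standard
    (simp_all add: scaleC_complex_def cinner_complex_def algebra_simps scaleR_conv_of_real
      inner_complex_def)

end

section \<open>Unbounded operators\<close>

text \<open>An operator is a partial map, so that its domain is \<open>dom\<close>, equality of operators is equality
  of domains and of values on the domain, \<open>B \<subseteq>\<^sub>m A\<close> says that \<open>B\<close> is a restriction of \<open>A\<close>, and
  \<open>A |` D\<close> restricts \<open>A\<close> to \<open>D\<close>.\<close>

definition linear_operator :: "('a::complex_hilbert_space \<rightharpoonup> 'a) \<Rightarrow> bool"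
  where "linear_operator A \<longleftrightarrow> csubspace (dom A) \<and>
    (\<forall>x\<in>dom A. \<forall>y\<in>dom A. the (A (x + y)) = the (A x) + the (A y)) \<and>
    (\<forall>c. \<forall>x\<in>dom A. the (A (c *\<^sub>C x)) = c *\<^sub>C the (A x))"

definition densely_defined :: "('a::complex_hilbert_space \<rightharpoonup> 'a) \<Rightarrow> bool"
  where "densely_defined A \<longleftrightarrow> closure (dom A) = UNIV"

definition closed_operator :: "('a::complex_hilbert_space \<rightharpoonup> 'a) \<Rightarrow> bool"
  where "closed_operator A \<longleftrightarrow> closed (Map.graph A)"

definition closable :: "('a::complex_hilbert_space \<rightharpoonup> 'a) \<Rightarrow> bool"
  where "closable A \<longleftrightarrow> (\<exists>B. linear_operator B \<and> closed_operator B \<and> A \<subseteq>\<^sub>m B)"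

text \<open>The operator whose graph is the closure of the graph of \<open>A\<close>; meaningful for closable \<open>A\<close>,
  where that closure is again a graph. The operators \<open>A\<close> and \<open>operator_closure A\<close> have the same
  adjoint. The correspondence has to exclude values of the adjoint in \<open>dom (operator_closure A)\<close>, not
  just those in \<open>dom A\<close>, unless \<open>A\<close> is closed: if \<open>A\<close> is the identity on a dense proper subspace and
  \<open>\<phi> \<notin> dom A\<close>, then \<open>M = span {\<phi>}\<close> satisfies the condition with \<open>dom A\<close>, but the corresponding
  restriction of the adjoint has the orthogonal complement of \<open>\<phi>\<close> as its domain, which is not
  dense.\<close>

definition operator_closure :: "('a::complex_hilbert_space \<rightharpoonup> 'a) \<Rightarrow> ('a \<rightharpoonup> 'a)"
  where "operator_closure A = (\<lambda>x.
    if \<exists>y. (x, y) \<in> closure (Map.graph A)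
    then Some (THE y. (x, y) \<in> closure (Map.graph A)) else None)"

text \<open>The vector \<open>z\<close> below is unique when \<open>A\<close> is densely defined.\<close>

definition adjoint_operator :: "('a::complex_hilbert_space \<rightharpoonup> 'a) \<Rightarrow> ('a \<rightharpoonup> 'a)"
  where "adjoint_operator A = (\<lambda>y.
    if \<exists>z. \<forall>x\<in>dom A. cinner y (the (A x)) = cinner z x
    then Some (THE z. \<forall>x\<in>dom A. cinner y (the (A x)) = cinner z x) else None)"

definition operator_kernel :: "('a::complex_hilbert_space \<rightharpoonup> 'a) \<Rightarrow> 'a set"
  where "operator_kernel A = {x \<in> dom A. the (A x) = 0}"

definition graph_norm :: "('a::complex_hilbert_space \<rightharpoonup> 'a) \<Rightarrow> 'a \<Rightarrow> real"
  where "graph_norm A x = sqrt ((norm x)\<^sup>2 + (norm (the (A x)))\<^sup>2)"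

text \<open>The closure is taken inside the normed space \<open>(dom A, graph_norm A)\<close>; \<open>M\<close> is assumed to be
  contained in \<open>dom A\<close>.\<close>

definition graph_norm_closure :: "('a::complex_hilbert_space \<rightharpoonup> 'a) \<Rightarrow> 'a set \<Rightarrow> 'a set"
  where "graph_norm_closure A M =
    {x \<in> dom A. \<forall>e>0. \<exists>y\<in>M. graph_norm A (x - y) < e}"

lemma operator_closure_closed:
  assumes "closed_operator A"
  shows "operator_closure A = A"
  using assms
  by (auto simp: operator_closure_def closed_operator_def Map.graph_def fun_eq_iff)

section \<open>The correspondence\<close>

definition restriction_of_adjoint ::
    "('a::complex_hilbert_space \<rightharpoonup> 'a) \<Rightarrow> 'a set \<Rightarrow> ('a \<rightharpoonup> 'a)"
  where "restriction_of_adjoint A M = adjoint_operator A |`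
    {f \<in> dom (adjoint_operator A). \<forall>\<phi>\<in>M.
      cinner f \<phi> + cinner (the (adjoint_operator A f)) (the (adjoint_operator A \<phi>)) = 0}"

end

theory Submission
  imports Defs
begin

text \<open>Let \<open>T\<close> be the adjoint of \<open>A\<close>, with graph \<open>G\<close>, and let \<open>N \<subseteq> G\<close> be the graph of \<open>T\<close> on \<open>M\<close>. The
  graph of the restriction belonging to \<open>M\<close> is \<open>G \<inter> N\<^sup>\<bottom>\<close>, the orthogonal complement of \<open>N\<close> in the
  Hilbert space \<open>G\<close>, and taking complements is an involution on the closed subspaces of \<open>G\<close>.
  It remains to see when the domain is dense. A vector \<open>h\<close> is orthogonal to the domain iff
  \<open>(h, 0) \<in> (G \<inter> N\<^sup>\<bottom>)\<^sup>\<bottom> = N + G\<^sup>\<bottom>\<close>, where \<open>G\<^sup>\<bottom>\<close> is the rotated graph of the closure of \<open>A\<close>, that is,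
  iff \<open>T \<phi>\<close> is mapped to \<open>h - \<phi>\<close> by the closure of \<open>A\<close> for some \<open>\<phi> \<in> M\<close>.\<close>

section \<open>Orthogonal complements in real Hilbert spaces\<close>

lemma subspace_closure:
  fixes S :: "'a::real_normed_vector set"
  assumes "subspace S"
  shows "subspace (closure S)"
  unfolding subspace_def
proof (intro conjI ballI allI)
  show "0 \<in> closure S"
    using assms closure_subset subspace_0 by blast
next
  fix x y assume "x \<in> closure S" "y \<in> closure S"
  then obtain X Y where "\<forall>n. X n \<in> S" "X \<longlonglongrightarrow> x" "\<forall>n. Y n \<in> S" "Y \<longlonglongrightarrow> y"
    unfolding closure_sequential by blast
  then have "\<forall>n. X n + Y n \<in> S" "(\<lambda>n. X n + Y n) \<longlonglongrightarrow> x + y"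
    using assms by (auto intro: subspace_add tendsto_add)
  then show "x + y \<in> closure S"
    unfolding closure_sequential by (intro exI[of _ "\<lambda>n. X n + Y n"] conjI)
next
  fix c :: real and x assume "x \<in> closure S"
  then obtain X where "\<forall>n. X n \<in> S" "X \<longlonglongrightarrow> x"
    unfolding closure_sequential by blast
  then have "\<forall>n. c *\<^sub>R X n \<in> S" "(\<lambda>n. c *\<^sub>R X n) \<longlonglongrightarrow> c *\<^sub>R x"
    using assms by (auto intro: subspace_scale tendsto_intros)
  then show "c *\<^sub>R x \<in> closure S"
    unfolding closure_sequential by (intro exI[of _ "\<lambda>n. c *\<^sub>R X n"] conjI)
qed

lemma closed_orthogonal_comp: "closed (S\<^sup>\<bottom>)"
proof -
  have "S\<^sup>\<bottom> = (\<Inter>y\<in>S. {x. inner y x = 0})"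
    by (auto simp: orthogonal_comp_def orthogonal_def)
  moreover have "closed {x. inner y x = 0}" for y :: 'a
    by (intro closed_Collect_eq continuous_intros)
  ultimately show ?thesis
    by auto
qed

text \<open>The vectors orthogonal to a fixed \<open>x\<close> form a closed set, so this set
  contains \<open>closure S\<close> as soon as it contains \<open>S\<close>.\<close>

lemma orthogonal_comp_closure: "(closure S)\<^sup>\<bottom> = S\<^sup>\<bottom>"
proof (intro equalityI subsetI)
  fix x assume "x \<in> S\<^sup>\<bottom>"
  then have "S \<subseteq> {y. inner y x = 0}"
    by (auto simp: orthogonal_comp_def orthogonal_def)
  moreover have "closed {y. inner y x = 0}"
    by (intro closed_Collect_eq continuous_intros)
  ultimately have "closure S \<subseteq> {y. inner y x = 0}"
    by (rule closure_minimal)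
  then show "x \<in> (closure S)\<^sup>\<bottom>"
    by (auto simp: orthogonal_comp_def orthogonal_def)
next
  fix x assume "x \<in> (closure S)\<^sup>\<bottom>"
  then show "x \<in> S\<^sup>\<bottom>"
    using closure_subset by (auto simp: orthogonal_comp_def)
qed

lemma minimal_distance_orthogonal:
  fixes z s :: "'a::real_inner"
  assumes "\<And>t. norm z \<le> norm (z - t *\<^sub>R s)"
  shows "inner s z = 0"
proof (cases "s = 0")
  case False
  \<comment> \<open>This \<open>t\<close> makes \<open>t *\<^sub>R s\<close> the projection of
    \<open>z\<close> onto the line through \<open>s\<close>. Subtracting it lowers the squared norm
    by \<open>(inner s z)\<^sup>2 / inner s s\<close>.\<close>
  define t where "t = inner s z / inner s s"
  have "inner z z \<le> inner (z - t *\<^sub>R s) (z - t *\<^sub>R s)"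
    using assms[of t] by (simp add: norm_le)
  also have "\<dots> = inner z z - (inner s z)\<^sup>2 / inner s s"
    using False
    by (simp add: t_def inner_diff inner_commute[of z s] power2_eq_square)
  finally have le: "(inner s z)\<^sup>2 / inner s s \<le> 0"
    by simp
  show ?thesis
  proof (rule ccontr)
    assume "inner s z \<noteq> 0"
    then have "0 < (inner s z)\<^sup>2 / inner s s"
      using False by simp
    with le show False
      by simp
  qed
qed simp

text \<open>A minimizing sequence for the distance from \<open>x\<close> to \<open>S\<close> is Cauchy by the parallelogram law.\<close>

lemma closed_subspace_orthogonal_decomposition:
  fixes S :: "'a::{real_inner,complete_space} set"
  assumes "subspace S" "closed S"
  obtains y where "y \<in> S" "x - y \<in> S\<^sup>\<bottom>"
proof -
  define d where "d = (INF y\<in>S. (norm (x - y))\<^sup>2)"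
  have bdd: "bdd_below ((\<lambda>y. (norm (x - y))\<^sup>2) ` S)"
    by (rule bdd_belowI[of _ 0]) auto
  have "S \<noteq> {}"
    using subspace_0[OF assms(1)] by blast
  have d_le: "d \<le> (norm (x - y))\<^sup>2" if "y \<in> S" for y
    unfolding d_def by (rule cINF_lower[OF bdd that])
  have "\<exists>y\<in>S. (norm (x - y))\<^sup>2 < d + inverse (real (Suc n))" for n
    using cINF_less_iff[OF \<open>S \<noteq> {}\<close> bdd, of "d + inverse (real (Suc n))"] unfolding d_def by simp
  then obtain Y where Y: "\<And>n. Y n \<in> S"
      "\<And>n. (norm (x - Y n))\<^sup>2 < d + inverse (real (Suc n))"
    by metis
  have dist_Y: "(norm (Y m - Y n))\<^sup>2 \<le> 2 * inverse (real (Suc m)) + 2 * inverse (real (Suc n))"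
    for m n
  proof -
    \<comment> \<open>The midpoint \<open>c\<close> lies in \<open>S\<close>, so its squared
      distance to \<open>x\<close> is at least \<open>d\<close>. In the parallelogram law the
      multiples of \<open>d\<close> cancel and only the two error terms remain.\<close>
    define c where "c = (1/2) *\<^sub>R (Y m + Y n)"
    have "c \<in> S"
      unfolding c_def using assms(1) Y(1) by (intro subspace_scale subspace_add)
    moreover have "(norm (Y m - Y n))\<^sup>2 =
        2 * (norm (x - Y m))\<^sup>2 + 2 * (norm (x - Y n))\<^sup>2 - 4 * (norm (x - c))\<^sup>2"
      unfolding c_def power2_norm_eq_inner
      by (simp add: inner_diff inner_add inner_commute algebra_simps)
    ultimately show ?thesis
      using d_le[of c] Y(2)[of m] Y(2)[of n] by linarith
  qed
  have "Cauchy Y"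
  proof (rule CauchyI)
    fix e :: real assume "0 < e"
    then obtain N where N: "inverse (real (Suc N)) < e\<^sup>2 / 4"
      using reals_Archimedean[of "e\<^sup>2 / 4"] by auto
    have "norm (Y m - Y n) < e" if "m \<ge> N" "n \<ge> N" for m n
    proof (rule power_less_imp_less_base)
      have "inverse (real (Suc m)) \<le> inverse (real (Suc N))"
           "inverse (real (Suc n)) \<le> inverse (real (Suc N))"
        using that by (auto intro!: le_imp_inverse_le)
      then show "(norm (Y m - Y n))\<^sup>2 < e\<^sup>2"
        using dist_Y[of m n] N by linarith
    qed (use \<open>0 < e\<close> in simp)
    then show "\<exists>N. \<forall>m\<ge>N. \<forall>n\<ge>N. norm (Y m - Y n) < e"
      by blast
  qed
  then obtain y where y: "Y \<longlonglongrightarrow> y"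
    using Cauchy_convergent convergent_def by blast
  have "y \<in> S"
    using closed_sequentially[OF assms(2)] Y(1) y by blast
  have le_d: "(norm (x - y))\<^sup>2 \<le> d"
  proof (rule LIMSEQ_le)
    show "(\<lambda>n. (norm (x - Y n))\<^sup>2) \<longlonglongrightarrow> (norm (x - y))\<^sup>2"
      by (intro tendsto_intros y)
    show "(\<lambda>n. d + inverse (real (Suc n))) \<longlonglongrightarrow> d"
      using tendsto_add[OF tendsto_const LIMSEQ_inverse_real_of_nat, of d] by simp
    show "\<exists>N. \<forall>n\<ge>N. (norm (x - Y n))\<^sup>2 \<le> d + inverse (real (Suc n))"
      using Y(2) less_imp_le by blast
  qed
  have nearest: "norm (x - y) \<le> norm (x - w)" if "w \<in> S" for w
    by (rule power2_le_imp_le[OF order_trans[OF le_d d_le[OF that]] norm_ge_zero])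
  have "inner s (x - y) = 0" if "s \<in> S" for s
  proof (rule minimal_distance_orthogonal)
    fix t
    have "y + t *\<^sub>R s \<in> S"
      using assms(1) \<open>y \<in> S\<close> that by (intro subspace_add subspace_scale)
    then show "norm (x - y) \<le> norm (x - y - t *\<^sub>R s)"
      using nearest by (metis diff_diff_eq)
  qed
  then have "x - y \<in> S\<^sup>\<bottom>"
    by (auto simp: orthogonal_comp_def orthogonal_def)
  with \<open>y \<in> S\<close> show thesis
    by (rule that)
qed

text \<open>Project \<open>x\<close> to \<open>y\<close> in \<open>closure S\<close>. The remainder
  \<open>x - y\<close> is orthogonal to \<open>y\<close> and, lying in
  \<open>S\<^sup>\<bottom>\<close>, also to \<open>x\<close>, hence to itself.\<close>

lemma orthogonal_comp_orthogonal_comp: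
  fixes S :: "'a::{real_inner,complete_space} set"
  assumes "subspace S"
  shows "S\<^sup>\<bottom>\<^sup>\<bottom> = closure S"
proof (intro equalityI subsetI)
  fix x assume x: "x \<in> S\<^sup>\<bottom>\<^sup>\<bottom>"
  obtain y where y: "y \<in> closure S" "x - y \<in> (closure S)\<^sup>\<bottom>"
    using closed_subspace_orthogonal_decomposition[OF subspace_closure[OF assms] closed_closure] .
  have "x - y \<in> S\<^sup>\<bottom>"
    using y(2) by (simp only: orthogonal_comp_closure)
  then have "inner (x - y) x = 0"
    using x by (simp add: orthogonal_comp_def[of "S\<^sup>\<bottom>"] orthogonal_def)
  moreover have "inner (x - y) y = 0"
    using y by (simp add: orthogonal_comp_def orthogonal_def inner_commute)
  ultimately have "inner (x - y) (x - y) = 0"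
    by (simp add: inner_diff_right)
  then show "x \<in> closure S"
    using y(1) by simp
next
  have "S \<subseteq> S\<^sup>\<bottom>\<^sup>\<bottom>"
    by (auto simp: orthogonal_comp_def orthogonal_commute)
  then show "x \<in> S\<^sup>\<bottom>\<^sup>\<bottom>" if "x \<in> closure S" for x
    using that closure_minimal closed_orthogonal_comp by blast
qed

lemma dense_subspace_iff:
  fixes S :: "'a::{real_inner,complete_space} set"
  assumes "subspace S"
  shows "closure S = UNIV \<longleftrightarrow> S\<^sup>\<bottom> = {0}"
proof
  assume "closure S = UNIV"
  then have "S\<^sup>\<bottom> = UNIV\<^sup>\<bottom>"
    by (metis orthogonal_comp_closure)
  then show "S\<^sup>\<bottom> = {0}"
    by simp
next
  assume "S\<^sup>\<bottom> = {0}"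
  then show "closure S = UNIV"
    using orthogonal_comp_orthogonal_comp[OF assms] by simp
qed

text \<open>This is the identity \<open>(G \<inter> N\<^sup>\<bottom>)\<^sup>\<bottom> = N +
  G\<^sup>\<bottom>\<close>. Projecting \<open>z\<close> to \<open>N\<close> and the remainder to
  \<open>G\<close> leaves a component \<open>g\<close> in
  \<open>G \<inter> N\<^sup>\<bottom>\<close> that has to vanish.\<close>

lemma orthogonal_comp_Int_orthogonal_comp:
  fixes G N :: "'a::{real_inner,complete_space} set"
  assumes "subspace G" "closed G" "subspace N" "closed N" "N \<subseteq> G"
  shows "z \<in> (G \<inter> N\<^sup>\<bottom>)\<^sup>\<bottom> \<longleftrightarrow> (\<exists>n\<in>N. z - n \<in> G\<^sup>\<bottom>)"
proof
  assume z: "z \<in> (G \<inter> N\<^sup>\<bottom>)\<^sup>\<bottom>"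
  obtain n where n: "n \<in> N" "z - n \<in> N\<^sup>\<bottom>"
    using closed_subspace_orthogonal_decomposition[OF assms(3,4)] .
  obtain g where g: "g \<in> G" "z - n - g \<in> G\<^sup>\<bottom>"
    using closed_subspace_orthogonal_decomposition[OF assms(1,2)] .
  \<comment> \<open>Both \<open>z - n\<close> and \<open>z - n - g\<close> are orthogonal to
    \<open>N\<close>, the latter because \<open>N \<subseteq> G\<close>; so is their difference
    \<open>g\<close>.\<close>
  have "g \<in> N\<^sup>\<bottom>"
    using n(2) g(2) assms(5)
    by (fastforce simp: orthogonal_comp_def orthogonal_def inner_diff_right)
  have "inner g z = 0"
    using z g(1) \<open>g \<in> N\<^sup>\<bottom>\<close> by (auto simp: orthogonal_comp_def orthogonal_def)
  moreover have "inner g n = 0"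
    using \<open>g \<in> N\<^sup>\<bottom>\<close> n(1) by (auto simp: orthogonal_comp_def orthogonal_def inner_commute)
  moreover have "inner g (z - n - g) = 0"
    using g by (auto simp: orthogonal_comp_def orthogonal_def)
  ultimately have "g = 0"
    by (simp add: inner_diff_right)
  with g n show "\<exists>n\<in>N. z - n \<in> G\<^sup>\<bottom>"
    by auto
next
  assume "\<exists>n\<in>N. z - n \<in> G\<^sup>\<bottom>"
  then obtain n where n: "n \<in> N" "z - n \<in> G\<^sup>\<bottom>" ..
  show "z \<in> (G \<inter> N\<^sup>\<bottom>)\<^sup>\<bottom>"
    unfolding orthogonal_comp_def orthogonal_def
  proof (safe)
    fix y assume "y \<in> G" "\<forall>w\<in>N. inner w y = 0"
    then show "inner y z = 0"
      using n by (auto simp: orthogonal_comp_def orthogonal_def inner_diff_right inner_commute)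
  qed
qed

text \<open>For \<open>z\<close> in \<open>G\<close>, the difference \<open>z - n\<close> of the
  preceding description lies in both \<open>G\<close> and \<open>G\<^sup>\<bottom>\<close>, so it is
  zero.\<close>

lemma Int_orthogonal_comp_involution:
  fixes G N :: "'a::{real_inner,complete_space} set"
  assumes "subspace G" "closed G" "subspace N" "closed N" "N \<subseteq> G"
  shows "G \<inter> (G \<inter> N\<^sup>\<bottom>)\<^sup>\<bottom> = N"
proof (intro equalityI subsetI)
  fix z assume z: "z \<in> G \<inter> (G \<inter> N\<^sup>\<bottom>)\<^sup>\<bottom>"
  then obtain n where n: "n \<in> N" "z - n \<in> G\<^sup>\<bottom>"
    using orthogonal_comp_Int_orthogonal_comp[OF assms] by blast
  have "z - n \<in> G"
    using z n(1) assms(1,5) by (auto intro: subspace_diff)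
  with n(2) have "inner (z - n) (z - n) = 0"
    by (auto simp: orthogonal_comp_def orthogonal_def)
  then show "z \<in> N"
    using n(1) by simp
next
  fix z assume "z \<in> N"
  then show "z \<in> G \<inter> (G \<inter> N\<^sup>\<bottom>)\<^sup>\<bottom>"
    using assms(5) by (auto simp: orthogonal_comp_def orthogonal_commute)
qed

section \<open>Complex inner products and linear operators\<close>

lemma cinner_add_left: "cinner (x + y) z = cinner x z + cinner y z"
  by (metis cinner_add_right cinner_commute complex_cnj_add)

lemma cinner_scaleC_left: "cinner (c *\<^sub>C x) z = cnj c * cinner x z"
  by (metis cinner_commute cinner_scaleC_right complex_cnj_mult)

lemma cinner_zero_left: "cinner 0 x = 0"
  using cinner_add_left[of 0 0 x] by simp

lemma Re_cinner: "Re (cinner x y) = inner x y"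
  by (simp add: inner_eq_Re_cinner)

text \<open>On sets stable under multiplication by \<open>\<i>\<close>, this allows complex
  relations to be recovered from real ones.\<close>

lemma Im_cinner: "Im (cinner x y) = - inner x (\<i> *\<^sub>C y)"
  by (simp add: inner_eq_Re_cinner cinner_scaleC_right)

lemma csubspace_imp_subspace: "csubspace S \<Longrightarrow> subspace S"
  by (simp add: complex_vector.subspace_def subspace_def scaleR_eq_scaleC)

context
  fixes T :: "'a::complex_hilbert_space \<rightharpoonup> 'a"
  assumes T: "linear_operator T"
begin

lemma linear_operator_csubspace: "csubspace (dom T)"
  using T by (simp add: linear_operator_def)

lemma linear_operator_add:
  "x \<in> dom T \<Longrightarrow> y \<in> dom T \<Longrightarrow> the (T (x + y)) = the (T x) + the (T y)"
  using T unfolding linear_operator_def by blast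

lemma linear_operator_scaleC: "x \<in> dom T \<Longrightarrow> the (T (c *\<^sub>C x)) = c *\<^sub>C the (T x)"
  using T unfolding linear_operator_def by blast

lemma linear_operator_zero: "the (T 0) = 0"
  using linear_operator_scaleC[of 0 0] complex_vector.subspace_0[OF linear_operator_csubspace]
  by simp

lemma linear_operator_diff:
  assumes "x \<in> dom T" "y \<in> dom T"
  shows "the (T (x - y)) = the (T x) - the (T y)"
proof -
  have "the (T (x + (-1) *\<^sub>C y)) = the (T x) + (-1) *\<^sub>C the (T y)"
    using assms linear_operator_add linear_operator_scaleC linear_operator_csubspace
    by (metis complex_vector.subspace_scale)
  then show ?thesis
    by simp
qed

lemma linear_operator_restrict:
  assumes "csubspace D" "D \<subseteq> dom T"
  shows "linear_operator (T |` D)"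
proof -
  have "dom (T |` D) = D"
    using assms(2) by auto
  then show ?thesis
    using assms unfolding linear_operator_def
    by (auto simp: complex_vector.subspace_add complex_vector.subspace_scale
        linear_operator_add linear_operator_scaleC subset_iff domIff)
qed

text \<open>Graphs are treated as subspaces of the underlying real Hilbert space
  \<open>'a \<times> 'a\<close>, where the projection arguments apply.\<close>

lemma subspace_graph: "subspace (Map.graph T)"
  unfolding Map.graph_eq_to_snd_dom
proof (rule subspaceI)
  note subspace = linear_operator_csubspace
  show "0 \<in> (\<lambda>x. (x, the (T x))) ` dom T"
    using complex_vector.subspace_0[OF subspace] linear_operator_zero
    by (intro image_eqI[of _ _ 0]) (simp_all add: zero_prod_def)
  show "p + q \<in> (\<lambda>x. (x, the (T x))) ` dom T"
    if p: "p \<in> (\<lambda>x. (x, the (T x))) ` dom T" and q: "q \<in> (\<lambda>x. (x, the (T x))) ` dom T" for p q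
  proof -
    obtain x y where xy: "x \<in> dom T" "y \<in> dom T" "p = (x, the (T x))" "q = (y, the (T y))"
      using p q by blast
    then show ?thesis
      using complex_vector.subspace_add[OF subspace xy(1,2)]
      by (intro image_eqI[of _ _ "x + y"]) (simp_all add: linear_operator_add)
  qed
  show "r *\<^sub>R p \<in> (\<lambda>x. (x, the (T x))) ` dom T"
    if p: "p \<in> (\<lambda>x. (x, the (T x))) ` dom T" for r p
  proof -
    obtain x where x: "x \<in> dom T" "p = (x, the (T x))"
      using p by blast
    then have "r *\<^sub>R p = (complex_of_real r *\<^sub>C x, the (T (complex_of_real r *\<^sub>C x)))"
      by (simp add: scaleR_eq_scaleC linear_operator_scaleC)
    then show ?thesis
      using complex_vector.subspace_scale[OF subspace x(1), of "complex_of_real r"] by (rule image_eqI)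
  qed
qed

end

lemma graph_restrict:
  assumes "M \<subseteq> dom T"
  shows "Map.graph (T |` M) = (\<lambda>x. (x, the (T x))) ` M"
proof -
  have "dom (T |` M) = M"
    using assms by auto
  then show ?thesis
    by (simp add: Map.graph_eq_to_snd_dom cong: image_cong)
qed

lemma graph_restrict_subset: "Map.graph (T |` M) \<subseteq> Map.graph T"
  by (auto simp: Map.graph_def restrict_map_def split: if_splits)

lemma restrict_map_dom:
  assumes "C \<subseteq>\<^sub>m T"
  shows "C = T |` dom C"
proof
  fix x
  show "C x = (T |` dom C) x"
  proof (cases "x \<in> dom C")
    case True
    then have "C x = T x"
      using assms unfolding map_le_def by blast
    with True show ?thesis
      by simp
  next
    case False
    then show ?thesis
      by (simp add: domIff)
  qed
qed

section \<open>Orthogonal complements in the graph norm\<close>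

text \<open>The orthogonal complement of \<open>M\<close> in \<open>dom T\<close> for the inner
  product inducing the graph norm. If \<open>T\<close> is the adjoint of \<open>A\<close>, it is the
  domain of \<open>restriction_of_adjoint A M\<close>.\<close>

definition graph_orthogonal :: "('a::complex_hilbert_space \<rightharpoonup> 'a) \<Rightarrow> 'a set \<Rightarrow> 'a set"
  where "graph_orthogonal T M =
    {f \<in> dom T. \<forall>\<phi>\<in>M. cinner f \<phi> + cinner (the (T f)) (the (T \<phi>)) = 0}"

lemma graph_orthogonal_subset: "graph_orthogonal T M \<subseteq> dom T"
  by (auto simp: graph_orthogonal_def)

context
  fixes T :: "'a::complex_hilbert_space \<rightharpoonup> 'a"
  assumes T: "linear_operator T"
begin

lemma csubspace_graph_orthogonal: "csubspace (graph_orthogonal T M)"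
proof (rule complex_vector.subspaceI)
  show "0 \<in> graph_orthogonal T M"
    using complex_vector.subspace_0[OF linear_operator_csubspace[OF T]]
    by (simp add: graph_orthogonal_def linear_operator_zero[OF T] cinner_zero_left)
next
  fix x y assume xy: "x \<in> graph_orthogonal T M" "y \<in> graph_orthogonal T M"
  then have dom: "x \<in> dom T" "y \<in> dom T"
    by (simp_all add: graph_orthogonal_def)
  have "cinner (x + y) \<phi> + cinner (the (T (x + y))) w =
      (cinner x \<phi> + cinner (the (T x)) w) + (cinner y \<phi> + cinner (the (T y)) w)" for \<phi> w
    using dom by (simp add: linear_operator_add[OF T] cinner_add_left)
  then show "x + y \<in> graph_orthogonal T M"
    using xy complex_vector.subspace_add[OF linear_operator_csubspace[OF T] dom]
    by (simp add: graph_orthogonal_def)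
next
  fix c x assume x: "x \<in> graph_orthogonal T M"
  then have dom: "x \<in> dom T"
    by (simp add: graph_orthogonal_def)
  have "cinner (c *\<^sub>C x) \<phi> + cinner (the (T (c *\<^sub>C x))) w =
      cnj c * (cinner x \<phi> + cinner (the (T x)) w)" for \<phi> w
    using dom by (simp add: linear_operator_scaleC[OF T] cinner_scaleC_left distrib_left)
  then show "c *\<^sub>C x \<in> graph_orthogonal T M"
    using x complex_vector.subspace_scale[OF linear_operator_csubspace[OF T] dom]
    by (simp add: graph_orthogonal_def)
qed

text \<open>For complex subspaces, orthogonality with respect to the real inner product of the product
  space amounts to orthogonality with respect to the complex one.\<close>

lemma graph_restrict_graph_orthogonal:
  assumes "csubspace M" "M \<subseteq> dom T"
  shows "Map.graph (T |` graph_orthogonal T M) = Map.graph T \<inter> (Map.graph (T |` M))\<^sup>\<bottom>"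
proof -
  have "(\<forall>\<phi>\<in>M. cinner f \<phi> + cinner g (the (T \<phi>)) = 0) \<longleftrightarrow>
      (\<forall>\<phi>\<in>M. inner \<phi> f + inner (the (T \<phi>)) g = 0)" (is "?L \<longleftrightarrow> ?R") for f g
  proof
    assume ?L
    then have "\<forall>\<phi>\<in>M. Re (cinner f \<phi> + cinner g (the (T \<phi>))) = 0"
      by simp
    then show ?R
      by (simp add: Re_cinner inner_commute)
  next
    assume R: ?R
    show ?L
    proof
      fix \<phi> assume "\<phi> \<in> M"
      \<comment> \<open>The real relation at \<open>\<phi>\<close> gives the real part of the
        complex one, and the real relation at \<open>\<i> *\<^sub>C \<phi>\<close> gives its
        imaginary part.\<close>
      then have "\<i> *\<^sub>C \<phi> \<in> M"
        using assms(1) by (rule complex_vector.subspace_scale[rotated])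
      then have "inner (\<i> *\<^sub>C \<phi>) f + inner (\<i> *\<^sub>C the (T \<phi>)) g = 0"
        using R linear_operator_scaleC[OF T] \<open>\<phi> \<in> M\<close> assms(2) by (metis subsetD)
      moreover have "inner \<phi> f + inner (the (T \<phi>)) g = 0"
        using R \<open>\<phi> \<in> M\<close> by blast
      ultimately show "cinner f \<phi> + cinner g (the (T \<phi>)) = 0"
        by (intro complex_eqI) (simp_all add: Re_cinner Im_cinner inner_commute)
    qed
  qed
  then have "graph_orthogonal T M = {f \<in> dom T. (f, the (T f)) \<in> (Map.graph (T |` M))\<^sup>\<bottom>}"
    by (simp add: graph_orthogonal_def graph_restrict[OF assms(2)] orthogonal_comp_def
        orthogonal_def)
  then show ?thesis
    by (auto simp: graph_restrict[OF graph_orthogonal_subset] Map.graph_eq_to_snd_dom)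
qed

lemma closed_graph_orthogonal:
  assumes "closed_operator T" "csubspace M" "M \<subseteq> dom T"
  shows "closed_operator (T |` graph_orthogonal T M)"
  using assms(1) unfolding closed_operator_def graph_restrict_graph_orthogonal[OF assms(2,3)]
  by (intro closed_Int closed_orthogonal_comp)

text \<open>On graphs, both complements are taken inside the Hilbert space
  \<open>Map.graph T\<close>, where they cancel on closed subspaces. First components then give back
  \<open>M\<close>.\<close>

lemma graph_orthogonal_involution:
  assumes "closed_operator T" "csubspace M" "M \<subseteq> dom T" "closed_operator (T |` M)"
  shows "graph_orthogonal T (graph_orthogonal T M) = M"
proof -
  have "Map.graph (T |` graph_orthogonal T (graph_orthogonal T M)) = Map.graph (T |` M)"
    unfolding graph_restrict_graph_orthogonal[OF csubspace_graph_orthogonal graph_orthogonal_subset]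
      graph_restrict_graph_orthogonal[OF assms(2,3)]
  proof (rule Int_orthogonal_comp_involution)
    show "subspace (Map.graph T)" "subspace (Map.graph (T |` M))"
      using T assms by (auto intro: subspace_graph linear_operator_restrict)
  qed (use assms graph_restrict_subset in \<open>auto simp: closed_operator_def\<close>)
  then have "fst ` Map.graph (T |` graph_orthogonal T (graph_orthogonal T M)) =
      fst ` Map.graph (T |` M)"
    by simp
  then show ?thesis
    using assms(3) graph_orthogonal_subset[of T "graph_orthogonal T M"]
    by (simp add: Map.fst_graph_eq_dom Int_absorb1)
qed

text \<open>By linearity, the graph norm of \<open>x - y\<close> is the distance between the points
  of the graph over \<open>x\<close> and \<open>y\<close>. Closure in the graph norm thus becomes
  closure in the product space.\<close>

lemma graph_norm_closure_iff:
  assumes "M \<subseteq> dom T"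
  shows "x \<in> graph_norm_closure T M \<longleftrightarrow>
    x \<in> dom T \<and> (x, the (T x)) \<in> closure (Map.graph (T |` M))"
proof -
  have "graph_norm T (x - y) = dist (y, the (T y)) (x, the (T x))" if "x \<in> dom T" "y \<in> M" for y
    using that assms
    by (simp add: graph_norm_def dist_Pair_Pair linear_operator_diff[OF T] subset_iff
        dist_commute[of y] dist_commute[of "the (T y)"] flip: dist_norm)
  then show ?thesis
    by (simp add: graph_norm_closure_def closure_approachable graph_restrict[OF assms]
        cong: conj_cong)
qed

lemma graph_norm_closure_eq_iff:
  assumes "closed_operator T" "M \<subseteq> dom T"
  shows "graph_norm_closure T M = M \<longleftrightarrow> closed_operator (T |` M)"
proof
  assume eq: "graph_norm_closure T M = M"
  \<comment> \<open>As \<open>T\<close> is closed, every limit point has the form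
    \<open>(x, the (T x))\<close> with \<open>x\<close> in \<open>dom T\<close>, so the graph norm
    closure, taken inside \<open>dom T\<close>, misses none of them.\<close>
  have "closure (Map.graph (T |` M)) \<subseteq> Map.graph T"
    using assms(1) graph_restrict_subset[of T M] by (simp add: closed_operator_def closure_minimal)
  have "p \<in> Map.graph (T |` M)" if p: "p \<in> closure (Map.graph (T |` M))" for p
  proof -
    obtain x where x: "x \<in> dom T" "p = (x, the (T x))"
      using p \<open>closure (Map.graph (T |` M)) \<subseteq> Map.graph T\<close>
      unfolding Map.graph_eq_to_snd_dom[of T] by blast
    then have "x \<in> M"
      using p graph_norm_closure_iff[OF assms(2), of x] eq by simp
    with x show ?thesis
      by (simp add: graph_restrict[OF assms(2)])
  qed
  then have "closure (Map.graph (T |` M)) \<subseteq> Map.graph (T |` M)"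
    by blast
  then show "closed_operator (T |` M)"
    by (metis closed_operator_def closure_subset closed_closure subset_antisym)
next
  assume "closed_operator (T |` M)"
  then have "x \<in> graph_norm_closure T M \<longleftrightarrow> x \<in> dom T \<and> x \<in> M" for x
    by (auto simp: graph_norm_closure_iff[OF assms(2)] closed_operator_def
        graph_restrict[OF assms(2)])
  then show "graph_norm_closure T M = M"
    using assms(2) by blast
qed

end

section \<open>The adjoint of a densely defined closable operator\<close>

lemma dom_operator_closure:
  "x \<in> dom (operator_closure A) \<longleftrightarrow> (\<exists>y. (x, y) \<in> closure (Map.graph A))"
  by (simp add: operator_closure_def dom_def)

text \<open>The closure stays inside the graph of a closed linear extension, which maps 0 to
  0.\<close>

lemma closable_graph_closure:
  assumes "closable A" "(0, h) \<in> closure (Map.graph A)"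
  shows "h = 0"
proof -
  obtain B where B: "linear_operator B" "closed_operator B" "A \<subseteq>\<^sub>m B"
    using assms(1) unfolding closable_def by blast
  have "Map.graph A \<subseteq> Map.graph B"
    using B(3) by (force simp: Map.graph_def map_le_def)
  then have "closure (Map.graph A) \<subseteq> Map.graph B"
    using B(2) by (simp add: closure_minimal closed_operator_def)
  then have "B 0 = Some h"
    using assms(2) by (auto dest: Map.in_graphD)
  then show ?thesis
    using linear_operator_zero[OF B(1)] by simp
qed

context
  fixes A :: "'a::complex_hilbert_space \<rightharpoonup> 'a"
  assumes A: "linear_operator A" and dense: "densely_defined A"
begin

text \<open>Two candidates for the value differ by a vector orthogonal to the dense domain of
  \<open>A\<close>, so they agree and the \<open>THE\<close> is well defined.\<close>

lemma adjoint_operator_eq_Some_iff: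
  "adjoint_operator A y = Some z \<longleftrightarrow> (\<forall>x\<in>dom A. cinner y (the (A x)) = cinner z x)"
proof -
  have unique: "w = z" if w: "\<forall>x\<in>dom A. cinner y (the (A x)) = cinner w x"
    and z: "\<forall>x\<in>dom A. cinner y (the (A x)) = cinner z x" for w z
  proof -
    have "inner w x = inner z x" if "x \<in> dom A" for x
      using that w z by (simp add: inner_eq_Re_cinner)
    then have "w - z \<in> (dom A)\<^sup>\<bottom>"
      by (simp add: orthogonal_comp_def orthogonal_def inner_diff_right inner_commute)
    then show ?thesis
      using dense dense_subspace_iff[OF csubspace_imp_subspace[OF linear_operator_csubspace[OF A]]]
      by (simp add: densely_defined_def)
  qed
  show ?thesis
  proof
    assume *: "adjoint_operator A y = Some z"
    then obtain w where w: "\<forall>x\<in>dom A. cinner y (the (A x)) = cinner w x"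
      by (auto simp: adjoint_operator_def split: if_splits)
    then have "adjoint_operator A y = Some w"
      using unique by (auto simp: adjoint_operator_def intro!: the_equality)
    with * w show "\<forall>x\<in>dom A. cinner y (the (A x)) = cinner z x"
      by simp
  next
    assume "\<forall>x\<in>dom A. cinner y (the (A x)) = cinner z x"
    then show "adjoint_operator A y = Some z"
      using unique by (auto simp: adjoint_operator_def intro!: the_equality)
  qed
qed

text \<open>The domain is stable under \<open>\<i>\<close>, so testing \<open>x\<close> and
  \<open>\<i> *\<^sub>C x\<close> recovers the complex relation. The real form makes the adjoint
  accessible to orthogonality of graphs.\<close>

lemma adjoint_operator_eq_Some_iff_inner:
  "adjoint_operator A y = Some z \<longleftrightarrow> (\<forall>x\<in>dom A. inner y (the (A x)) = inner z x)"
proof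
  assume "adjoint_operator A y = Some z"
  then show "\<forall>x\<in>dom A. inner y (the (A x)) = inner z x"
    by (simp add: adjoint_operator_eq_Some_iff inner_eq_Re_cinner)
next
  assume R: "\<forall>x\<in>dom A. inner y (the (A x)) = inner z x"
  show "adjoint_operator A y = Some z"
    unfolding adjoint_operator_eq_Some_iff
  proof
    fix x assume "x \<in> dom A"
    moreover from this have "\<i> *\<^sub>C x \<in> dom A"
      using linear_operator_csubspace[OF A] complex_vector.subspace_scale by blast
    ultimately have "inner y (the (A x)) = inner z x"
        "inner y (\<i> *\<^sub>C the (A x)) = inner z (\<i> *\<^sub>C x)"
      using R linear_operator_scaleC[OF A] by metis+
    then show "cinner y (the (A x)) = cinner z x"
      by (intro complex_eqI) (simp_all add: Re_cinner Im_cinner)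
  qed
qed

lemma linear_operator_adjoint: "linear_operator (adjoint_operator A)"
proof -
  have 0: "adjoint_operator A 0 = Some 0"
    by (simp add: adjoint_operator_eq_Some_iff cinner_zero_left)
  have add: "adjoint_operator A (x + y) = Some (u + v)"
    if "adjoint_operator A x = Some u" "adjoint_operator A y = Some v" for x y u v
    using that by (simp add: adjoint_operator_eq_Some_iff cinner_add_left)
  have scale: "adjoint_operator A (c *\<^sub>C x) = Some (c *\<^sub>C u)"
    if "adjoint_operator A x = Some u" for c x u
    using that by (simp add: adjoint_operator_eq_Some_iff cinner_scaleC_left)
  have "csubspace (dom (adjoint_operator A))"
    using 0 add scale unfolding dom_def by (intro complex_vector.subspaceI) blast+
  then show ?thesis
    unfolding linear_operator_def by (auto simp: add scale)
qed

text \<open>The relation \<open>inner y (the (A x)) = inner z x\<close> says that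
  \<open>(- z, y)\<close> is orthogonal to \<open>(x, the (A x))\<close>: the adjoint has the
  rotated orthogonal complement of the graph of \<open>A\<close> as its graph.\<close>

lemma graph_adjoint:
  "(y, z) \<in> Map.graph (adjoint_operator A) \<longleftrightarrow> (- z, y) \<in> (Map.graph A)\<^sup>\<bottom>"
  by (auto simp: Map.graph_def adjoint_operator_eq_Some_iff_inner orthogonal_comp_def
      orthogonal_def inner_commute add_eq_0_iff)
     (metis domI inner_commute option.sel)+

lemma closed_adjoint: "closed_operator (adjoint_operator A)"
proof -
  have "Map.graph (adjoint_operator A) = (\<lambda>p. (- snd p, fst p)) -` ((Map.graph A)\<^sup>\<bottom>)"
    by (auto simp: graph_adjoint)
  then show ?thesis
    unfolding closed_operator_def
    by (auto intro!: closed_vimage closed_orthogonal_comp continuous_intros)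
qed

lemma orthogonal_comp_graph_adjoint:
  "(u, v) \<in> (Map.graph (adjoint_operator A))\<^sup>\<bottom> \<longleftrightarrow> (- v, u) \<in> closure (Map.graph A)"
proof -
  have "(u, v) \<in> (Map.graph (adjoint_operator A))\<^sup>\<bottom> \<longleftrightarrow>
      (\<forall>y z. (- z, y) \<in> (Map.graph A)\<^sup>\<bottom> \<longrightarrow> inner y u + inner z v = 0)"
    by (simp add: orthogonal_comp_def[of "Map.graph (adjoint_operator A)"] orthogonal_def
        Ball_def graph_adjoint)
  \<comment> \<open>Substituting \<open>p = - z\<close> and \<open>q = y\<close> moves the rotation
    to \<open>(u, v)\<close> and exposes a double complement, which is the closure.\<close>
  also have "\<dots> \<longleftrightarrow> (\<forall>p q. (p, q) \<in> (Map.graph A)\<^sup>\<bottom> \<longrightarrow> inner q u - inner p v = 0)"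
    by (metis (no_types, opaque_lifting) add_uminus_conv_diff inner_minus_left minus_minus)
  also have "\<dots> \<longleftrightarrow> (- v, u) \<in> (Map.graph A)\<^sup>\<bottom>\<^sup>\<bottom>"
    by (auto simp: orthogonal_comp_def[of "(Map.graph A)\<^sup>\<bottom>"] orthogonal_def)
  finally show ?thesis
    by (simp add: orthogonal_comp_orthogonal_comp[OF subspace_graph[OF A]])
qed

text \<open>Density means that no nonzero \<open>h\<close> arises from a \<open>\<phi>\<close> in
  \<open>M\<close> whose image \<open>the (T \<phi>)\<close> the closure of \<open>A\<close> maps to
  \<open>h - \<phi>\<close>. The range condition forces \<open>the (T \<phi>) = 0\<close>, the
  kernel condition then \<open>\<phi> = 0\<close>, and closability \<open>h = 0\<close>.\<close>

lemma dense_graph_orthogonal_iff: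
  assumes closable: "closable A"
    and M: "csubspace M" "M \<subseteq> dom (adjoint_operator A)"
    and "closed_operator (adjoint_operator A |` M)"
  shows "closure (graph_orthogonal (adjoint_operator A) M) = UNIV \<longleftrightarrow>
    operator_kernel (adjoint_operator A) \<inter> M = {0} \<and>
    {the (adjoint_operator A \<phi>) |\<phi>. \<phi> \<in> M} \<inter> dom (operator_closure A) = {0}"
    (is "?dense \<longleftrightarrow> ?cond")
proof -
  define T where "T = adjoint_operator A"
  define G where "G = Map.graph T"
  define N where "N = Map.graph (T |` M)"
  have T: "linear_operator T" "closed_operator T"
    unfolding T_def by (rule linear_operator_adjoint closed_adjoint)+
  have subspaces: "subspace G" "closed G" "subspace N" "closed N" "N \<subseteq> G"
    using T assms graph_restrict_subset
    by (auto simp: G_def N_def T_def closed_operator_def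
        intro: subspace_graph linear_operator_restrict)
  have N_eq: "N = (\<lambda>x. (x, the (T x))) ` M"
    using M(2) by (simp add: N_def T_def graph_restrict)
  have perp: "h \<in> (graph_orthogonal T M)\<^sup>\<bottom> \<longleftrightarrow>
      (\<exists>\<phi>\<in>M. (the (T \<phi>), h - \<phi>) \<in> closure (Map.graph A))" for h
  proof -
    \<comment> \<open>Pairing \<open>(h, 0)\<close> with a point of a graph sees only its first
      component, so orthogonality to the domain becomes orthogonality to the graph.\<close>
    have "h \<in> (graph_orthogonal T M)\<^sup>\<bottom> \<longleftrightarrow> (h, 0) \<in> (G \<inter> N\<^sup>\<bottom>)\<^sup>\<bottom>"
      unfolding G_def N_def
        graph_restrict_graph_orthogonal[OF T(1) M(1) M(2)[folded T_def], symmetric]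
      by (auto simp: graph_restrict[OF graph_orthogonal_subset] orthogonal_comp_def orthogonal_def)
    also have "\<dots> \<longleftrightarrow> (\<exists>\<phi>\<in>M. (h - \<phi>, - the (T \<phi>)) \<in> G\<^sup>\<bottom>)"
      unfolding orthogonal_comp_Int_orthogonal_comp[OF subspaces] by (simp add: N_eq)
    finally show ?thesis
      by (simp add: G_def T_def orthogonal_comp_graph_adjoint)
  qed
  have "0 \<in> M"
    using M(1) by (rule complex_vector.subspace_0)
  have T0: "the (T 0) = 0"
    by (rule linear_operator_zero[OF T(1)])
  have graph0: "(0, 0) \<in> closure (Map.graph A)"
    using subspace_0[OF subspace_closure[OF subspace_graph[OF A]]] by (simp add: zero_prod_def)
  have kernel0: "0 \<in> operator_kernel T"
    using M \<open>0 \<in> M\<close> T0 by (auto simp: operator_kernel_def T_def)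
  have dom0: "0 \<in> dom (operator_closure A)"
    using graph0 unfolding dom_operator_closure by blast
  have "?dense \<longleftrightarrow> (graph_orthogonal T M)\<^sup>\<bottom> = {0}"
    unfolding T_def[symmetric]
    by (rule dense_subspace_iff[OF csubspace_imp_subspace[OF csubspace_graph_orthogonal[OF T(1)]]])
  also have "\<dots> \<longleftrightarrow> ?cond"
  proof
    assume trivial: "(graph_orthogonal T M)\<^sup>\<bottom> = {0}"
    \<comment> \<open>Each such pair makes \<open>h = v + \<phi>\<close> orthogonal to the
      domain.\<close>
    have vanish: "v + \<phi> = 0" if "\<phi> \<in> M" "(the (T \<phi>), v) \<in> closure (Map.graph A)" for \<phi> v
    proof -
      have "v + \<phi> \<in> (graph_orthogonal T M)\<^sup>\<bottom>"
        unfolding perp using that by (intro bexI[of _ \<phi>]) simp_all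
      then show ?thesis
        unfolding trivial by simp
    qed
    \<comment> \<open>The choice \<open>v = 0\<close> is admissible here, since
      \<open>(0, 0)\<close> lies in the closure of the graph.\<close>
    then have "\<phi> = 0" if "\<phi> \<in> M" "the (T \<phi>) = 0" for \<phi>
      using that graph0 by (metis add_0)
    moreover have "the (T \<phi>) = 0"
      if \<phi>: "\<phi> \<in> M" "the (T \<phi>) \<in> dom (operator_closure A)" for \<phi>
    proof -
      obtain v where v: "(the (T \<phi>), v) \<in> closure (Map.graph A)"
        using \<phi>(2) unfolding dom_operator_closure by blast
      then have "v = - \<phi>"
        using vanish \<phi>(1) by (simp add: eq_neg_iff_add_eq_0)
      \<comment> \<open>The point \<open>(\<phi>, the (T \<phi>))\<close> lies in \<open>G\<close>
        and its negative in \<open>G\<^sup>\<bottom>\<close>, so it is orthogonal to itself and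
        vanishes.\<close>
      with v have "(- \<phi>, - the (T \<phi>)) \<in> G\<^sup>\<bottom>"
        by (simp add: G_def T_def orthogonal_comp_graph_adjoint)
      moreover have "(\<phi>, the (T \<phi>)) \<in> G"
        using \<phi>(1) subspaces(5) by (auto simp: N_eq)
      ultimately have "orthogonal (\<phi>, the (T \<phi>)) (- \<phi>, - the (T \<phi>))"
        unfolding orthogonal_comp_def by blast
      then have "inner \<phi> \<phi> + inner (the (T \<phi>)) (the (T \<phi>)) = 0"
        by (simp add: orthogonal_def)
      then show ?thesis
        by (auto simp: add_nonneg_eq_0_iff T0)
    qed
    ultimately show ?cond
      unfolding T_def[symmetric] using kernel0 dom0 \<open>0 \<in> M\<close> T0[symmetric]
      unfolding operator_kernel_def by blast
  next
    assume ?cond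
    then have kernel: "operator_kernel T \<inter> M = {0}"
      and range: "{the (T \<phi>) |\<phi>. \<phi> \<in> M} \<inter> dom (operator_closure A) = {0}"
      by (simp_all add: T_def)
    show "(graph_orthogonal T M)\<^sup>\<bottom> = {0}"
    proof (intro equalityI subsetI)
      fix h assume "h \<in> (graph_orthogonal T M)\<^sup>\<bottom>"
      then obtain \<phi> where \<phi>: "\<phi> \<in> M" "(the (T \<phi>), h - \<phi>) \<in> closure (Map.graph A)"
        using perp by blast
      then have "the (T \<phi>) \<in> dom (operator_closure A)"
        unfolding dom_operator_closure by blast
      then have "the (T \<phi>) = 0"
        using range \<phi>(1) by blast
      with \<phi>(1) M(2) have "\<phi> = 0"
        using kernel by (auto simp: operator_kernel_def T_def)
      with \<phi>(2) T0 show "h \<in> {0}"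
        using closable_graph_closure[OF closable] by simp
    qed (use subspace_0[OF subspace_orthogonal_comp] in auto)
  qed
  finally show ?thesis .
qed

end

theorem corollary2p14:
  fixes A :: "'a::complex_hilbert_space \<rightharpoonup> 'a"
  assumes "linear_operator A" and "densely_defined A" and "closable A"
  shows "bij_betw (restriction_of_adjoint A)
    {M. csubspace M \<and> M \<subseteq> dom (adjoint_operator A) \<and>
      graph_norm_closure (adjoint_operator A) M = M \<and>
      operator_kernel (adjoint_operator A) \<inter> graph_norm_closure (adjoint_operator A) M = {0} \<and>
      {the (adjoint_operator A \<phi>) |\<phi>. \<phi> \<in> graph_norm_closure (adjoint_operator A) M}
        \<inter> dom (operator_closure A) = {0}}
    {C. linear_operator C \<and> densely_defined C \<and> closed_operator C \<and> C \<subseteq>\<^sub>m adjoint_operator A}"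
proof -
  define T where "T = adjoint_operator A"
  have T: "linear_operator T" "closed_operator T"
    unfolding T_def using assms by (auto intro: linear_operator_adjoint closed_adjoint)
  define P where "P = {M. csubspace M \<and> M \<subseteq> dom T \<and> closed_operator (T |` M) \<and>
    closure (graph_orthogonal T M) = UNIV}"
  define Q where "Q = {C. linear_operator C \<and> densely_defined C \<and> closed_operator C \<and> C \<subseteq>\<^sub>m T}"
  have dom_restrict: "dom (T |` graph_orthogonal T M) = graph_orthogonal T M" for M
    using graph_orthogonal_subset by auto
  have "bij_betw (\<lambda>M. T |` graph_orthogonal T M) P Q"
  \<comment> \<open>The inverse sends a restriction to the graph complement of its domain; both
    compositions reduce to the involution.\<close>
  proof (rule bij_betw_byWitness[where f' = "\<lambda>C. graph_orthogonal T (dom C)"])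
    show "\<forall>M\<in>P. graph_orthogonal T (dom (T |` graph_orthogonal T M)) = M"
      unfolding dom_restrict by (simp add: P_def graph_orthogonal_involution T)
    \<comment> \<open>A restriction of \<open>T\<close> is determined by its domain, so closedness
      of \<open>C\<close> is the closedness that the involution requires of
      \<open>dom C\<close>.\<close>
    have Q: "csubspace (dom C)" "dom C \<subseteq> dom T" "T |` dom C = C" "closed_operator C"
        "closure (dom C) = UNIV" if "C \<in> Q" for C
      using that restrict_map_dom[of C T] map_le_implies_dom_le[of C T]
      by (auto simp: Q_def densely_defined_def linear_operator_csubspace)
    show "\<forall>C\<in>Q. T |` graph_orthogonal T (graph_orthogonal T (dom C)) = C"
      by (simp add: Q graph_orthogonal_involution T)
    show "(\<lambda>M. T |` graph_orthogonal T M) ` P \<subseteq> Q"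
    proof
      fix C assume "C \<in> (\<lambda>M. T |` graph_orthogonal T M) ` P"
      then obtain M where M: "M \<in> P" "C = T |` graph_orthogonal T M"
        by blast
      have "linear_operator C"
        unfolding M(2) using T(1) csubspace_graph_orthogonal[OF T(1)] graph_orthogonal_subset
        by (rule linear_operator_restrict)
      moreover have "closed_operator C"
        unfolding M(2) using M(1) by (simp add: P_def closed_graph_orthogonal T)
      moreover have "densely_defined C"
        unfolding M(2) densely_defined_def dom_restrict using M(1) by (simp add: P_def)
      moreover have "C \<subseteq>\<^sub>m T"
        unfolding map_le_def M(2) dom_restrict by simp
      ultimately show "C \<in> Q"
        by (simp add: Q_def)
    qed
    show "(\<lambda>C. graph_orthogonal T (dom C)) ` Q \<subseteq> P"
    proof
      fix M assume "M \<in> (\<lambda>C. graph_orthogonal T (dom C)) ` Q"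
      then obtain C where C: "C \<in> Q" "M = graph_orthogonal T (dom C)"
        by blast
      \<comment> \<open>The density required by \<open>P\<close> concerns the complement of
        \<open>M\<close>, which by the involution is \<open>dom C\<close>.\<close>
      then show "M \<in> P"
        by (simp add: P_def Q graph_orthogonal_involution T graph_orthogonal_subset
            csubspace_graph_orthogonal closed_graph_orthogonal)
    qed
  qed
  moreover have "restriction_of_adjoint A = (\<lambda>M. T |` graph_orthogonal T M)"
    by (simp add: fun_eq_iff restriction_of_adjoint_def graph_orthogonal_def T_def)
  moreover have "csubspace M \<and> M \<subseteq> dom T \<and> graph_norm_closure T M = M \<and>
      operator_kernel T \<inter> graph_norm_closure T M = {0} \<and>
      {the (T \<phi>) |\<phi>. \<phi> \<in> graph_norm_closure T M} \<inter> dom (operator_closure A) = {0} \<longleftrightarrow> M \<in> P" for M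
  \<comment> \<open>Outside these three conditions both sides are false, because closedness of
    \<open>M\<close> in the graph norm amounts to closedness of the restriction of \<open>T\<close>
    to \<open>M\<close>.\<close>
  proof (cases "csubspace M \<and> M \<subseteq> dom T \<and> closed_operator (T |` M)")
    case True
    then have "graph_norm_closure T M = M"
      by (simp add: graph_norm_closure_eq_iff T)
    then show ?thesis
      unfolding P_def using True dense_graph_orthogonal_iff[OF assms, of M, folded T_def] by simp
  next
    case False
    then show ?thesis
      unfolding P_def using graph_norm_closure_eq_iff[OF T, of M] by blast
  qed
  ultimately show ?thesis
    by (simp add: Q_def T_def)
qed

end
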